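(* Let $\mathcal{H}$ be a real Hilbert space. Let $f:\mathcal{H}\to\mathbb{R}$ and $g:\mathcal{H}\to\mathbb{R}\cup\{+\infty\}$ be proper and lower semi-continuous, with $f$ Fréchet differentiable with $\beta$-Lipschitz continuous gradient $\nabla f$, $\mathrm{dom}\,f\cap\mathrm{dom}\,g\neq\emptyset$ and $\mathrm{Arg}\min(f+g)\neq\emptyset$. Let $\mathcal{Q}:\mathcal{H}\to\mathcal{H}$ be linear, bounded, self-adjoint, with closed range, and degenerate, i.e. positive semi-definite with $\ker\mathcal{Q}\setminus\{0\}\neq\emptyset$. Assume $\mathrm{ran}\,\nabla f\subseteq\mathrm{ran}\,\mathcal{Q}$ and $\mathrm{ran}(\partial g+\mathcal{Q})\supseteq\mathrm{ran}(\mathcal{Q}-\nabla f)$. Let $\nu\in\,]0,+\infty[$ be a constant with $\|\mathcal{Q}x\|\ge\nu\|x\|$ for all $x\in(\ker\mathcal{Q})^\perp=\mathrm{ran}\,\mathcal{Q}$. Let $x^0\in\mathcal{H}$, let $\{x^k\}_{k\in\mathbb{N}}$ be generated by $x^{k+1}:=(\partial g+\mathcal{Q})^{-1}(\mathcal{Q}-\nabla f)x^k$, and put $h:=f+g$. Then, for every $k\in\mathbb{N}$: (i) (without assuming convexity of $f$ or $g$) $$h(x^k)-h(x^{k+1})\ge\frac12\Big(1-\frac{\beta}{\nu}\Big)\|x^{k+1}-x^k\|_{\mathcal{Q}}^2;$$ (ii) if in addition $g$ is convex, $$h(x^k)-h(x^{k+1})\ge\Big(1-\frac{\beta}{2\n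u}\Big)\|x^{k+1}-x^k\|_{\mathcal{Q}}^2.$$
   Context: $\|x\|_{\mathcal{Q}}^2:=\langle\mathcal{Q}x|x\rangle$ (a seminorm when $\mathcal{Q}$ is degenerate). $\mathrm{Arg}\min$ denotes the set of minimizers. $\partial g$ is the subdifferential in the sense of Bauschke–Combettes: $\partial g(x)=\{u\in\mathcal{H}:g(y)\ge g(x)+\langle u|y-x\rangle\ \forall y\in\mathcal{H}\}$ for $x\in\mathrm{dom}\,g$. The iteration means $0\in\partial g(x^{k+1})+\nabla f(x^k)+\mathcal{Q}(x^{k+1}-x^k)$. *)

theory Defs
  imports "HOL-Analysis.Analysis"
begin

definition eff_domain :: "('a \<Rightarrow> ereal) \<Rightarrow> 'a set" where
  "eff_domain F = {x. F x < \<infinity>}"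

definition proper_fun :: "('a \<Rightarrow> ereal) \<Rightarrow> bool" where
  "proper_fun F \<longleftrightarrow> (\<forall>x. F x \<noteq> -\<infinity>) \<and> eff_domain F \<noteq> {}"

definition lower_semicont :: "('a::topological_space \<Rightarrow> ereal) \<Rightarrow> bool" where
  "lower_semicont F \<longleftrightarrow> (\<forall>x. F x \<le> Liminf (nhds x) F)"

(* Convexity of an extended-real-valued function, as convexity of its epigraph in H x R:
   this avoids sums of infinities of opposite sign. *)
definition convex_fun :: "('a::real_vector \<Rightarrow> ereal) \<Rightarrow> bool" where
  "convex_fun F \<longleftrightarrow> convex {(x, r::real). F x \<le> ereal r}"

definition Argmin :: "('a \<Rightarrow> ereal) \<Rightarrow> 'a set" where
  "Argmin F = {x. \<forall>y. F x \<le> F y}"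

(* Global (not regular or limiting) subdifferential; empty outside the effective domain. *)
definition subdifferential :: "('a::real_inner \<Rightarrow> ereal) \<Rightarrow> 'a \<Rightarrow> 'a set" where
  "subdifferential F x =
     {u. x \<in> eff_domain F \<and> (\<forall>y. F y \<ge> F x + ereal (u \<bullet> (y - x)))}"

definition kernel :: "('a \<Rightarrow> 'b::zero) \<Rightarrow> 'a set" where
  "kernel Q = {x. Q x = 0}"

definition seminorm_sq :: "('a::real_inner \<Rightarrow> 'a) \<Rightarrow> 'a \<Rightarrow> real" where
  "seminorm_sq Q x = Q x \<bullet> x"

end

(* Every iterate satisfies the global subgradient inequality for g, so only the smooth part needs work.
   Since grad f takes values in ran Q = (ker Q)^bot, f is constant along ker Q, and the descent
   inequality along d = r + n (r in ran Q, n in ker Q) costs beta/2 |r|^2 rather than beta/2 |d|^2.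
   Finally nu |r|^2 <= <Q r, r> = <Q d, d>, by Cauchy-Schwarz for the form <Q a, b> applied to r and a
   preimage of r.  This gives (ii), and
   1 - beta/nu <= 2 - beta/nu turns it into (i). *)
theory Submission
  imports Defs
begin

text \<open>A sequence in \<open>M\<close> minimizing the distance to \<open>d\<close> is Cauchy by
  the parallelogram identity; its limit stays in the closed set \<open>M\<close> and attains the
  infimum, and minimality forces the residual to be orthogonal to \<open>M\<close>.\<close>

lemma orthogonal_projection_exists:
  fixes M :: "'a::{real_inner, complete_space} set"
  assumes "closed M" and M: "subspace M"
  obtains p where "p \<in> M" and "\<And>m. m \<in> M \<Longrightarrow> (d - p) \<bullet> m = 0"
proof -
  define S where "S = (\<lambda>m. (norm (d - m))\<^sup>2) ` M"
  define s where "s = Inf S"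
  have ne: "S \<noteq> {}" using subspace_0[OF M] by (auto simp: S_def)
  have bdd: "bdd_below S" by (rule bdd_belowI[of _ 0]) (auto simp: S_def)
  have s_le: "s \<le> (norm (d - m))\<^sup>2" if "m \<in> M" for m
    unfolding s_def using that bdd by (auto simp: S_def intro: cInf_lower)
  have "\<exists>m\<in>M. (norm (d - m))\<^sup>2 < s + 1 / real (Suc n)" for n
  proof -
    have "Inf S < s + 1 / real (Suc n)" by (simp add: s_def)
    then show ?thesis using cInf_lessD[OF ne] by (fastforce simp: S_def)
  qed
  then obtain p where pM: "\<And>n. p n \<in> M"
    and p_lt: "\<And>n. (norm (d - p n))\<^sup>2 < s + 1 / real (Suc n)" by metis
  have "Cauchy p"
  proof (rule metric_CauchyI)
    fix e :: real assume "0 < e"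
    then obtain N where N: "inverse (real (Suc N)) < e\<^sup>2 / 4"
      using reals_Archimedean[of "e\<^sup>2 / 4"] by auto
    have "dist (p i) (p j) < e" if "N \<le> i" "N \<le> j" for i j
    proof -
      \<comment> \<open>The midpoint cannot beat the infimum \<open>s\<close>, so the parallelogram
        identity below bounds the squared gap by 4 (s + e^2/4) - 4 s = e^2; this fixes the choice of
        \<open>N\<close>.\<close>
      have "(1/2) *\<^sub>R (p i + p j) \<in> M"
        using pM M by (simp add: subspace_add subspace_scale)
      then have mid: "s \<le> (norm (d - (1/2) *\<^sub>R (p i + p j)))\<^sup>2" by (rule s_le)
      have "1 / real (Suc i) \<le> inverse (real (Suc N))" "1 / real (Suc j) \<le> inverse (real (Suc N))"
        using that by (auto simp: field_simps)
      then have near: "(norm (d - p i))\<^sup>2 < s + e\<^sup>2 / 4" "(norm (d - p j))\<^sup>2 < s + e\<^sup>2 / 4"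
        using p_lt[of i] p_lt[of j] N by linarith+
      have "(norm (p i - p j))\<^sup>2 = 2 * (norm (d - p i))\<^sup>2 + 2 * (norm (d - p j))\<^sup>2
          - 4 * (norm (d - (1/2) *\<^sub>R (p i + p j)))\<^sup>2"
        unfolding power2_norm_eq_inner
        by (simp add: algebra_simps inner_commute)
      also have "\<dots> < e\<^sup>2" using mid near by linarith
      finally show ?thesis
        using \<open>0 < e\<close> by (simp add: dist_norm power_less_imp_less_base)
    qed
    then show "\<exists>N. \<forall>i\<ge>N. \<forall>j\<ge>N. dist (p i) (p j) < e" by blast
  qed
  then obtain q where q: "p \<longlonglongrightarrow> q" by (auto simp: Cauchy_convergent_iff convergent_def)
  have qM: "q \<in> M" using closed_sequentially[OF \<open>closed M\<close>] pM q by blast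
  have "(\<lambda>n. (norm (d - p n))\<^sup>2) \<longlonglongrightarrow> (norm (d - q))\<^sup>2"
    by (intro tendsto_intros q)
  moreover have "(\<lambda>n. s + 1 / real (Suc n)) \<longlonglongrightarrow> s + 0"
    by (intro tendsto_add tendsto_const lim_1_over_n[THEN LIMSEQ_Suc])
  ultimately have q_min: "(norm (d - q))\<^sup>2 \<le> s"
    using p_lt by (intro LIMSEQ_le[of _ _ "\<lambda>n. s + 1 / real (Suc n)"]) (auto intro: less_imp_le)
  show thesis
  proof (rule that[OF qM])
    fix m assume m: "m \<in> M"
    show "(d - q) \<bullet> m = 0"
    proof (cases "m = 0")
      case False
      then have pos: "0 < m \<bullet> m" by simp
      define c where "c = (d - q) \<bullet> m"
      \<comment> \<open>This \<open>t\<close> minimizes the squared distance from \<open>d\<close>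
        to \<open>q + t *\<^sub>R m\<close>. The gain there is c^2 / (m . m), which minimality of
        \<open>q\<close> forces to vanish.\<close>
      define t where "t = c / (m \<bullet> m)"
      have "(norm (d - q))\<^sup>2 \<le> (norm (d - (q + t *\<^sub>R m)))\<^sup>2"
        using qM m M by (intro order_trans[OF q_min s_le]) (simp add: subspace_add subspace_scale)
      also have "\<dots> = (norm (d - q))\<^sup>2 - 2 * t * c + t\<^sup>2 * (m \<bullet> m)"
        unfolding power2_norm_eq_inner c_def
        by (simp add: algebra_simps inner_commute power2_eq_square)
      also have "\<dots> = (norm (d - q))\<^sup>2 - c\<^sup>2 / (m \<bullet> m)"
        using pos by (simp add: t_def field_simps power2_eq_square)
      finally have "c\<^sup>2 / (m \<bullet> m) \<le> 0" by simp
      then show ?thesis using pos by (simp add: divide_le_0_iff c_def)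
    qed simp
  qed
qed

text \<open>The form is nonnegative on the span of \<open>a\<close> and \<open>b\<close>, so its
  discriminant has a sign. As the form may be degenerate, \<open>C = 0\<close> does not give
  \<open>b = 0\<close> and is treated separately.\<close>

lemma psd_Cauchy_Schwarz:
  fixes Q :: "'a::real_inner \<Rightarrow> 'a"
  assumes lin: "linear Q" and sym: "\<And>y z. Q y \<bullet> z = y \<bullet> Q z" and psd: "\<And>y. 0 \<le> Q y \<bullet> y"
  shows "(Q a \<bullet> b)\<^sup>2 \<le> (Q a \<bullet> a) * (Q b \<bullet> b)"
proof -
  define A B C where "A = Q a \<bullet> a" and "B = Q a \<bullet> b" and "C = Q b \<bullet> b"
  have quad: "0 \<le> A * u\<^sup>2 + 2 * B * u * v + C * v\<^sup>2" for u v
  proof -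
    have "Q b \<bullet> a = B" using sym[of b a] by (simp add: B_def inner_commute)
    then have "Q (u *\<^sub>R a + v *\<^sub>R b) \<bullet> (u *\<^sub>R a + v *\<^sub>R b) = A * u\<^sup>2 + 2 * B * u * v + C * v\<^sup>2"
      by (simp add: linear_add[OF lin] linear_scale[OF lin] A_def B_def C_def
          algebra_simps power2_eq_square)
    then show ?thesis using psd by metis
  qed
  have "0 \<le> A" "0 \<le> C" using psd by (auto simp: A_def C_def)
  show "B\<^sup>2 \<le> A * C"
  proof (cases "C = 0")
    case True
    have "B = 0"
    proof (rule ccontr)
      assume "B \<noteq> 0"
      \<comment> \<open>With \<open>C = 0\<close> and u = 1 the quadratic is affine in v, and the
        chosen v gives it the value -1.\<close>
      then show False
        using quad[of 1 "- (A + 1) / (2 * B)"] True by (simp add: field_simps)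
    qed
    then show ?thesis using True by simp
  next
    case False
    then have "0 < C" using \<open>0 \<le> C\<close> by simp
    \<comment> \<open>Taking u = C and v = -B makes the quadratic factor as C (A C - B^2).\<close>
    moreover have "0 \<le> C * (A * C - B\<^sup>2)"
      using quad[of C "- B"] by (simp add: algebra_simps power2_eq_square)
    ultimately show ?thesis by (simp add: zero_le_mult_iff)
  qed
qed

text \<open>Take \<open>r\<close> to be the projection of \<open>d\<close> onto the closed range; by
  symmetry of \<open>Q\<close>, a residual orthogonal to the range lies in the kernel.\<close>

lemma closed_range_decomposition:
  fixes Q :: "'a::{real_inner, complete_space} \<Rightarrow> 'a"
  assumes lin: "linear Q" and sym: "\<And>y z. Q y \<bullet> z = y \<bullet> Q z" and closed: "closed (range Q)"
  obtains r n where "d = r + n" and "r \<in> range Q" and "Q n = 0"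
proof -
  obtain r where r: "r \<in> range Q" "\<And>m. m \<in> range Q \<Longrightarrow> (d - r) \<bullet> m = 0"
    using orthogonal_projection_exists[OF closed] linear_subspace_image[OF lin subspace_UNIV]
    by blast
  have "Q (d - r) \<bullet> Q (d - r) = 0" using r(2)[of "Q (Q (d - r))"] by (simp add: sym)
  then show thesis using that[of r "d - r"] r(1) by simp
qed

text \<open>Makes the lower bound by \<open>\<nu>\<close>, stated on the orthogonal complement of
  the kernel, available at points of the range.\<close>

lemma range_imp_kernel_orthogonal:
  assumes sym: "\<And>y z. Q y \<bullet> z = y \<bullet> Q z" and "v \<in> range Q"
  shows "v \<in> (kernel Q)\<^sup>\<bottom>"
  using assms(2) by (auto simp: orthogonal_comp_def orthogonal_def kernel_def sym[symmetric])

text \<open>The hypothesis bounds the norm of \<open>Q r\<close>, not the form. With r = Q e and e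
  in the range, Cauchy-Schwarz for the form gives |r|^4 <= (Q e . e) (Q r . r), while the bound at
  \<open>e\<close> gives \<nu> (Q e . e) <= |r|^2.\<close>

lemma psd_coercive_on_range:
  fixes Q :: "'a::{real_inner, complete_space} \<Rightarrow> 'a"
  assumes lin: "linear Q" and sym: "\<And>y z. Q y \<bullet> z = y \<bullet> Q z" and psd: "\<And>y. 0 \<le> Q y \<bullet> y"
    and closed: "closed (range Q)" and "0 < \<nu>"
    and bound: "\<And>y. y \<in> (kernel Q)\<^sup>\<bottom> \<Longrightarrow> \<nu> * norm y \<le> norm (Q y)"
    and r: "r \<in> range Q"
  shows "\<nu> * (norm r)\<^sup>2 \<le> Q r \<bullet> r"
proof (cases "r = 0")
  case False
  obtain a where "r = Q a" using r by blast
  \<comment> \<open>Dropping the kernel part of the preimage \<open>a\<close> keeps its image and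
    yields a preimage \<open>e\<close> to which \<open>bound\<close> applies.\<close>
  moreover obtain e n where "a = e + n" and e: "e \<in> range Q" and "Q n = 0"
    using closed_range_decomposition[OF lin sym closed] by blast
  ultimately have Qe: "Q e = r" by (simp add: linear_add[OF lin])
  define s where "s = (norm r)\<^sup>2"
  have "0 < s" using False by (simp add: s_def)
  have "\<nu> * (Q e \<bullet> e) \<le> \<nu> * (norm r * norm e)"
    using \<open>0 < \<nu>\<close> Qe norm_cauchy_schwarz[of r e] by simp
  also have "\<dots> = norm r * (\<nu> * norm e)" by simp
  also have "\<dots> \<le> norm r * norm r"
    using bound[OF range_imp_kernel_orthogonal[of Q, OF sym e]] Qe by (simp add: mult_left_mono)
  finally have e_le: "\<nu> * (Q e \<bullet> e) \<le> s" by (simp add: s_def power2_eq_square)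
  have "s\<^sup>2 \<le> (Q e \<bullet> e) * (Q r \<bullet> r)"
    using psd_Cauchy_Schwarz[OF lin sym psd, of e r] by (simp add: Qe s_def power2_norm_eq_inner)
  then have "\<nu> * s\<^sup>2 \<le> \<nu> * (Q e \<bullet> e) * (Q r \<bullet> r)"
    using \<open>0 < \<nu>\<close> by simp
  also have "\<dots> \<le> s * (Q r \<bullet> r)" using e_le psd by (rule mult_right_mono)
  finally have "s * (\<nu> * s) \<le> s * (Q r \<bullet> r)" by (simp add: power2_eq_square mult_ac)
  then show ?thesis using \<open>0 < s\<close> by (simp add: s_def)
qed simp

lemma GDERIV_along_line:
  fixes f :: "'a::real_inner \<Rightarrow> real"
  assumes "\<And>y. GDERIV f y :> gradf y"
  shows "((\<lambda>t. f (y + t *\<^sub>R v)) has_real_derivative gradf (y + t *\<^sub>R v) \<bullet> v) (at t)"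
proof -
  have line: "((\<lambda>t. y + t *\<^sub>R v) has_derivative (\<lambda>s. s *\<^sub>R v)) (at t)"
    by (auto intro!: derivative_eq_intros)
  have "(f has_derivative (\<lambda>w. w \<bullet> gradf (y + t *\<^sub>R v))) (at (y + t *\<^sub>R v))"
    using assms by (simp add: gderiv_def)
  from has_derivative_compose[OF line this] show ?thesis
    by (simp add: has_field_derivative_def inner_commute mult_commute_abs)
qed

text \<open>\<open>?\<phi>\<close> is the gap between \<open>f\<close> on the segment and its
  quadratic upper model, up to a constant. The Lipschitz bound makes its derivative nonpositive, so
  comparing the endpoints suffices.\<close>

lemma lipschitz_gradient_descent:
  fixes f :: "'a::real_inner \<Rightarrow> real"
  assumes grad: "\<And>y. GDERIV f y :> gradf y" and lip: "\<beta>-lipschitz_on UNIV gradf"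
  shows "f (y + v) \<le> f y + gradf y \<bullet> v + \<beta> / 2 * (norm v)\<^sup>2"
proof -
  let ?\<phi> = "\<lambda>t. f (y + t *\<^sub>R v) - t * (gradf y \<bullet> v) - \<beta> / 2 * t\<^sup>2 * (norm v)\<^sup>2"
  have "?\<phi> 1 \<le> ?\<phi> 0"
  proof (rule DERIV_nonpos_imp_nonincreasing[of 0 1 ?\<phi>])
    fix t :: real assume "0 \<le> t" "t \<le> 1"
    have "(?\<phi> has_real_derivative
        gradf (y + t *\<^sub>R v) \<bullet> v - gradf y \<bullet> v - \<beta> * t * (norm v)\<^sup>2) (at t)"
      by (auto intro!: derivative_eq_intros GDERIV_along_line[OF grad])
    moreover have "gradf (y + t *\<^sub>R v) \<bullet> v - gradf y \<bullet> v - \<beta> * t * (norm v)\<^sup>2 \<le> 0"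
    proof -
      have "(gradf (y + t *\<^sub>R v) - gradf y) \<bullet> v \<le> norm (gradf (y + t *\<^sub>R v) - gradf y) * norm v"
        by (rule norm_cauchy_schwarz)
      also have "\<dots> \<le> (\<beta> * norm (t *\<^sub>R v)) * norm v"
        using lipschitz_onD[OF lip, of "y + t *\<^sub>R v" y]
        by (intro mult_right_mono) (auto simp: dist_norm)
      finally show ?thesis
        using \<open>0 \<le> t\<close> by (simp add: inner_diff_left power2_eq_square mult_ac)
    qed
    ultimately show "\<exists>D. (?\<phi> has_real_derivative D) (at t) \<and> D \<le> 0" by blast
  qed simp
  then show ?thesis by simp
qed

text \<open>The derivative of \<open>f\<close> vanishes at every point of the line through
  \<open>y\<close> in direction \<open>n\<close>. This serves for kernel directions of
  \<open>Q\<close>.\<close>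

lemma constant_along_gradient_orthogonal:
  fixes f :: "'a::real_inner \<Rightarrow> real"
  assumes grad: "\<And>y. GDERIV f y :> gradf y" and orth: "\<And>y. gradf y \<bullet> n = 0"
  shows "f (y + n) = f y"
proof -
  have "((\<lambda>t. f (y + t *\<^sub>R n)) has_real_derivative 0) (at t)" for t
    using GDERIV_along_line[OF grad, of y n t] by (simp add: orth)
  then show ?thesis using DERIV_isconst_all[of "\<lambda>t. f (y + t *\<^sub>R n)" 1 0] by simp
qed

text \<open>The descent inequality is applied to the range part \<open>r\<close> of \<open>d\<close>
  alone: the kernel part changes neither \<open>f\<close> nor the linear term, and coercivity on the
  range bounds |r|^2 by the seminorm.\<close>

lemma seminorm_descent:
  fixes f :: "'a::{real_inner, complete_space} \<Rightarrow> real"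
  assumes grad: "\<And>y. GDERIV f y :> gradf y" and lip: "\<beta>-lipschitz_on UNIV gradf"
    and lin: "linear Q" and sym: "\<And>y z. Q y \<bullet> z = y \<bullet> Q z" and psd: "\<And>y. 0 \<le> Q y \<bullet> y"
    and closed: "closed (range Q)" and ran: "range gradf \<subseteq> range Q" and "0 < \<nu>"
    and bound: "\<And>y. y \<in> (kernel Q)\<^sup>\<bottom> \<Longrightarrow> \<nu> * norm y \<le> norm (Q y)"
  shows "f (y + d) \<le> f y + gradf y \<bullet> d + \<beta> / (2 * \<nu>) * seminorm_sq Q d"
proof -
  obtain r n where d: "d = r + n" and r: "r \<in> range Q" and n: "Q n = 0"
    using closed_range_decomposition[OF lin sym closed] by blast
  have orth: "w \<bullet> n = 0" if "w \<in> range Q" for w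
    using that n by (auto simp: sym)
  have grad_n: "gradf z \<bullet> n = 0" for z using orth ran by blast
  have "\<nu> * (norm r)\<^sup>2 \<le> Q r \<bullet> r"
    using psd_coercive_on_range[OF lin sym psd closed \<open>0 < \<nu>\<close> bound r] .
  also have "\<dots> = seminorm_sq Q d"
    using n orth[of "Q r"] by (simp add: seminorm_sq_def d linear_add[OF lin] inner_add_right)
  finally have "(norm r)\<^sup>2 \<le> seminorm_sq Q d / \<nu>"
    using \<open>0 < \<nu>\<close> by (simp add: field_simps)
  then have "\<beta> / 2 * (norm r)\<^sup>2 \<le> \<beta> / 2 * (seminorm_sq Q d / \<nu>)"
    using lipschitz_on_nonneg[OF lip] by (intro mult_left_mono) auto
  moreover have "f (y + d) = f (y + r)"
    using constant_along_gradient_orthogonal[OF grad grad_n, of "y + r"]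
    by (simp add: d add.assoc)
  moreover have "gradf y \<bullet> d = gradf y \<bullet> r" by (simp add: d inner_add_right grad_n)
  ultimately show ?thesis
    using lipschitz_gradient_descent[OF grad lip, of y r] by simp
qed

theorem lemma3p4:
  fixes f :: "'a::{real_inner, complete_space} \<Rightarrow> real"
    and gradf :: "'a \<Rightarrow> 'a"
    and g h :: "'a \<Rightarrow> ereal"
    and Q :: "'a \<Rightarrow> 'a"
    and \<beta> \<nu> :: real
    and x :: "nat \<Rightarrow> 'a"
  assumes f_proper: "proper_fun (\<lambda>y. ereal (f y))"
    and f_lsc: "lower_semicont (\<lambda>y. ereal (f y))"
    and g_proper: "proper_fun g"
    and g_lsc: "lower_semicont g"
    and f_grad: "\<And>y. GDERIV f y :> gradf y"
    and grad_lipschitz: "\<beta>-lipschitz_on UNIV gradf"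
    and dom_inter: "eff_domain (\<lambda>y. ereal (f y)) \<inter> eff_domain g \<noteq> {}"
    and h_eq: "h = (\<lambda>y. ereal (f y) + g y)"
    and argmin_nonempty: "Argmin h \<noteq> {}"
    and Q_bounded_linear: "bounded_linear Q"
    and Q_self_adjoint: "\<And>y z. Q y \<bullet> z = y \<bullet> Q z"
    and Q_closed_range: "closed (range Q)"
    and Q_psd: "\<And>y. 0 \<le> Q y \<bullet> y"
    and Q_degenerate: "kernel Q - {0} \<noteq> {}"
    and ran_grad: "range gradf \<subseteq> range Q"
    and ran_incl: "range (\<lambda>y. Q y - gradf y) \<subseteq> (\<Union>y. {u + Q y |u. u \<in> subdifferential g y})"
    and nu_pos: "0 < \<nu>"
    and nu_bound: "\<And>y. y \<in> (kernel Q)\<^sup>\<bottom> \<Longrightarrow> \<nu> * norm y \<le> norm (Q y)"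
    and iteration: "\<And>k. 0 \<in> {u + gradf (x k) + Q (x (Suc k) - x k) |u. u \<in> subdifferential g (x (Suc k))}"
  shows "\<forall>k.
      h (x k) - h (x (Suc k)) \<ge> ereal (1 / 2 * (1 - \<beta> / \<nu>) * seminorm_sq Q (x (Suc k) - x k))
    \<and> (convex_fun g \<longrightarrow>
      h (x k) - h (x (Suc k)) \<ge> ereal ((1 - \<beta> / (2 * \<nu>)) * seminorm_sq Q (x (Suc k) - x k)))"
proof
  fix k
  define d where "d = x (Suc k) - x k"
  define q where "q = seminorm_sq Q d"
  \<comment> \<open>The iteration is solved for its subgradient at the new iterate; the subgradient
    inequality is then tested at the old iterate \<open>x k\<close>.\<close>
  have "- gradf (x k) - Q d \<in> subdifferential g (x (Suc k))"
  proof -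
    obtain u where "u \<in> subdifferential g (x (Suc k))" and u: "0 = u + gradf (x k) + Q d"
      using iteration[of k] by (auto simp: d_def)
    moreover have "u = - gradf (x k) - Q d" using u by (simp add: algebra_simps eq_neg_iff_add_eq_0)
    ultimately show ?thesis by simp
  qed
  then have fin: "g (x (Suc k)) < \<infinity>"
    and "g (x k) \<ge> g (x (Suc k)) + ereal ((- gradf (x k) - Q d) \<bullet> (x k - x (Suc k)))"
    by (auto simp: subdifferential_def eff_domain_def)
  moreover have "(- gradf (x k) - Q d) \<bullet> (x k - x (Suc k)) = gradf (x k) \<bullet> d + q"
    by (simp add: d_def q_def seminorm_sq_def algebra_simps)
  ultimately have g_ge: "g (x k) \<ge> g (x (Suc k)) + ereal (gradf (x k) \<bullet> d + q)" by simp
  have f_le: "f (x (Suc k)) \<le> f (x k) + gradf (x k) \<bullet> d + \<beta> / (2 * \<nu>) * q"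
    using seminorm_descent[OF f_grad grad_lipschitz bounded_linear.linear[OF Q_bounded_linear]
        Q_self_adjoint Q_psd Q_closed_range ran_grad nu_pos nu_bound, of "x k" d]
    by (simp add: d_def q_def)
  \<comment> \<open>Finiteness of \<open>g\<close> at the new iterate keeps the extended-real
    difference in \<open>main\<close> from being infinity minus infinity.\<close>
  obtain b where b: "g (x (Suc k)) = ereal b"
    using fin g_proper by (cases "g (x (Suc k))") (auto simp: proper_fun_def)
  \<comment> \<open>For finite \<open>g (x k)\<close>, adding \<open>g_ge\<close> and
    \<open>f_le\<close> cancels the gradient terms and leaves q - \<beta> / (2 \<nu>) q. If
    \<open>g (x k)\<close> is infinite, so is the left side.\<close>
  have main: "h (x k) - h (x (Suc k)) \<ge> ereal ((1 - \<beta> / (2 * \<nu>)) * q)"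
  proof (cases "g (x k)")
    case (real a)
    then show ?thesis using g_ge f_le b by (simp add: h_eq left_diff_distrib)
  next
    case MInf
    then show ?thesis using g_proper by (simp add: proper_fun_def)
  qed (simp add: h_eq b)
  have "0 \<le> q" using Q_psd by (simp add: q_def seminorm_sq_def)
  \<comment> \<open>The two coefficients differ by exactly 1/2, so the weaker estimate follows from
    \<open>q\<close> being nonnegative.\<close>
  then have "1 / 2 * (1 - \<beta> / \<nu>) * q \<le> (1 - \<beta> / (2 * \<nu>)) * q"
    by (intro mult_right_mono) simp_all
  then have "ereal (1 / 2 * (1 - \<beta> / \<nu>) * q) \<le> h (x k) - h (x (Suc k))"
    by (intro order_trans[OF _ main]) simp
  then show "h (x k) - h (x (Suc k)) \<ge> ereal (1 / 2 * (1 - \<beta> / \<nu>) * seminorm_sq Q (x (Suc k) - x k))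
    \<and> (convex_fun g \<longrightarrow>
      h (x k) - h (x (Suc k)) \<ge> ereal ((1 - \<beta> / (2 * \<nu>)) * seminorm_sq Q (x (Suc k) - x k)))"
    using main by (simp add: q_def d_def)
qed

end
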